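(* Let $R$ be a commutative noetherian ring. The following conditions hold. (i) For every non-negative integer $n$, the subcategory $\mathcal D_{\leq n}$ of $R$-modules is Serre. (ii) The subcategory $\mathcal G$ of $R$-modules is Serre.
   Context: For an $R$-module $M$, $\overline{\dim}\,M=\dim R/\operatorname{Ann}_RM$ (Krull dimension of the quotient ring; the zero ring has dimension $-\infty$). $\mathcal D_{\leq n}$ is the full subcategory of all $R$-modules $M$ with $\overline{\dim}\,M\leq n$. $\mathcal G$ is the full subcategory of all $R$-modules $F$ such that $V(\operatorname{Ann}_RF)$ is a finite set, where $V(\mathfrak b)$ denotes the set of prime ideals containing $\mathfrak b$. A full subcategory is Serre if it is closed under taking subobjects, quotients and extensions. *)

theory Defs
  imports "HOL-Algebra.Algebra" "HOL-Library.Extended_Real"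
begin

definition Spec :: "('r, 'q) ring_scheme \<Rightarrow> 'r set set" where
  "Spec A = {P. primeideal P A}"

(* Supremum in the extended reals of the lengths n of chains P 0 < ... < P n of prime ideals.
   The supremum of the empty set is -\<infinity>, which gives the zero ring its dimension. *)
definition krull_dim :: "('r, 'q) ring_scheme \<Rightarrow> ereal" where
  "krull_dim A =
     (SUP n \<in> {n. \<exists>P :: nat \<Rightarrow> 'r set.
        (\<forall>i \<le> n. P i \<in> Spec A) \<and> (\<forall>i < n. P i \<subset> P (Suc i))}. ereal (real n))"

lemma krull_dim_zero_ring:
  fixes A :: "('a, 'q) ring_scheme"
  assumes "carrier A = {\<zero>\<^bsub>A\<^esub>}"
  shows "krull_dim A = -\<infinity>"
proof -
  have "P \<notin> Spec A" for P
  proof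
    assume "P \<in> Spec A"
    then interpret primeideal P A by (simp add: Spec_def)
    from assms a_subset zero_closed additive_subgroup.zero_closed[OF additive_subgroup_axioms]
    have "carrier A = P" by auto
    with I_notcarr show False by blast
  qed
  then have "{n. \<exists>P :: nat \<Rightarrow> 'a set.
      (\<forall>i \<le> n. P i \<in> Spec A) \<and> (\<forall>i < n. P i \<subset> P (Suc i))} = {}"
    by blast
  then show ?thesis
    unfolding krull_dim_def by (simp only: image_empty Sup_empty bot_ereal_def)
qed

definition annihilator :: "('r, 'q) ring_scheme \<Rightarrow> ('r, 'm, 'z) module_scheme \<Rightarrow> 'r set" where
  "annihilator R M = {r \<in> carrier R. \<forall>x \<in> carrier M. r \<odot>\<^bsub>M\<^esub> x = \<zero>\<^bsub>M\<^esub>}"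

definition V :: "('r, 'q) ring_scheme \<Rightarrow> 'r set \<Rightarrow> 'r set set" where
  "V R b = {P \<in> Spec R. b \<subseteq> P}"

definition dim_bar :: "('r, 'q) ring_scheme \<Rightarrow> ('r, 'm, 'z) module_scheme \<Rightarrow> ereal" where
  "dim_bar R M = krull_dim (R Quot annihilator R M)"

definition linear_maps ::
  "('r, 'q) ring_scheme \<Rightarrow> ('r, 'l, 'y) module_scheme \<Rightarrow> ('r, 'm, 'z) module_scheme \<Rightarrow> ('l \<Rightarrow> 'm) set"
  where
  "linear_maps R L M =
     {f \<in> carrier L \<rightarrow> carrier M.
        (\<forall>x \<in> carrier L. \<forall>y \<in> carrier L. f (x \<oplus>\<^bsub>L\<^esub> y) = f x \<oplus>\<^bsub>M\<^esub> f y) \<and>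
        (\<forall>r \<in> carrier R. \<forall>x \<in> carrier L. f (r \<odot>\<^bsub>L\<^esub> x) = r \<odot>\<^bsub>M\<^esub> f x)}"

(* A full subcategory of R-modules is given by its class of objects.  The type variable 'm plays
   the role of a universe: the ambient category consists of all R-modules whose carrier is a
   set of elements of 'm.  Since 'm is arbitrary, modules carried by different types are covered
   by embedding those types into their sum. *)
definition Modules :: "('r, 'q) ring_scheme \<Rightarrow> ('r, 'm) module set" where
  "Modules R = {M. module R M}"

(* Subobjects and quotients are the sources of monomorphisms and the targets of epimorphisms,
   i.e. of injective and surjective R-linear maps. *)
definition closed_under_subobjects ::
  "('r, 'q) ring_scheme \<Rightarrow> ('r, 'm) module set \<Rightarrow> bool" where
  "closed_under_subobjects R \<C> \<longleftrightarrow>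
     (\<forall>M \<in> \<C>. \<forall>L \<in> Modules R. \<forall>f \<in> linear_maps R L M.
        inj_on f (carrier L) \<longrightarrow> L \<in> \<C>)"

definition closed_under_quotients ::
  "('r, 'q) ring_scheme \<Rightarrow> ('r, 'm) module set \<Rightarrow> bool" where
  "closed_under_quotients R \<C> \<longleftrightarrow>
     (\<forall>M \<in> \<C>. \<forall>N \<in> Modules R. \<forall>g \<in> linear_maps R M N.
        g ` carrier M = carrier N \<longrightarrow> N \<in> \<C>)"

definition short_exact ::
  "('r, 'q) ring_scheme \<Rightarrow> ('r, 'l, 'x) module_scheme \<Rightarrow> ('l \<Rightarrow> 'm) \<Rightarrow>
     ('r, 'm, 'y) module_scheme \<Rightarrow> ('m \<Rightarrow> 'n) \<Rightarrow> ('r, 'n, 'z) module_scheme \<Rightarrow> bool" where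
  "short_exact R L f M g N \<longleftrightarrow>
     f \<in> linear_maps R L M \<and> g \<in> linear_maps R M N \<and>
     inj_on f (carrier L) \<and> f ` carrier L = a_kernel M N g \<and> g ` carrier M = carrier N"

definition closed_under_extensions ::
  "('r, 'q) ring_scheme \<Rightarrow> ('r, 'm) module set \<Rightarrow> bool" where
  "closed_under_extensions R \<C> \<longleftrightarrow>
     (\<forall>L \<in> \<C>. \<forall>N \<in> \<C>. \<forall>M \<in> Modules R. \<forall>f g. short_exact R L f M g N \<longrightarrow> M \<in> \<C>)"

definition Serre_subcategory ::
  "('r, 'q) ring_scheme \<Rightarrow> ('r, 'm) module set \<Rightarrow> bool" where
  "Serre_subcategory R \<C> \<longleftrightarrow>
     \<C> \<subseteq> Modules R \<and> closed_under_subobjects R \<C> \<and>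
     closed_under_quotients R \<C> \<and> closed_under_extensions R \<C>"

definition D_le :: "('r, 'q) ring_scheme \<Rightarrow> nat \<Rightarrow> ('r, 'm) module set" where
  "D_le R n = {M \<in> Modules R. dim_bar R M \<le> ereal (real n)}"

definition G_fin :: "('r, 'q) ring_scheme \<Rightarrow> ('r, 'm) module set" where
  "G_fin R = {F \<in> Modules R. finite (V R (annihilator R F))}"

end

theory Submission
  imports Defs
begin

text \<open>Prime ideals of \<open>R / Ann M\<close> are the primes in \<open>V (Ann M)\<close>, so both conditions depend on
  \<open>V (Ann M)\<close> only.  For an exact sequence \<open>0 \<rightarrow> L \<rightarrow> M \<rightarrow> N \<rightarrow> 0\<close> one has
  \<open>Ann L \<cdot> Ann N \<subseteq> Ann M \<subseteq> Ann L \<inter> Ann N\<close>, hence \<open>V (Ann M) = V (Ann L) \<union> V (Ann N)\<close>.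
  A chain of primes in this union lies in the part that contains its smallest member.\<close>

section \<open>Lengths of chains in families of sets\<close>

definition chain_dim :: "'a set set \<Rightarrow> ereal" where
  "chain_dim S =
     (SUP n \<in> {n. \<exists>P :: nat \<Rightarrow> 'a set.
        (\<forall>i \<le> n. P i \<in> S) \<and> (\<forall>i < n. P i \<subset> P (Suc i))}. ereal (real n))"

text \<open>Freed from the ring, the supremum applies to any family of sets: primes of R and of R /
  I, which have different types, become comparable, and so do subfamilies of a spectrum.\<close>

lemma krull_dim_eq_chain_dim: "krull_dim A = chain_dim (Spec A)"
  by (simp add: krull_dim_def chain_dim_def)

text \<open>\<open>f\<close> carries a chain in \<open>S\<close> to a chain of the same length in
  \<open>T\<close>, so every length counted for \<open>S\<close> is counted for
  \<open>T\<close>.\<close>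

lemma chain_dim_le_of_strict_mono:
  assumes "\<And>P. P \<in> S \<Longrightarrow> f P \<in> T"
    and "\<And>P Q. P \<in> S \<Longrightarrow> Q \<in> S \<Longrightarrow> P \<subset> Q \<Longrightarrow> f P \<subset> f Q"
  shows "chain_dim S \<le> chain_dim T"
  unfolding chain_dim_def
proof (rule SUP_subset_mono, rule subsetI)
  fix n
  assume "n \<in> {n. \<exists>P :: nat \<Rightarrow> 'a set. (\<forall>i \<le> n. P i \<in> S) \<and> (\<forall>i < n. P i \<subset> P (Suc i))}"
  then obtain P where "\<forall>i \<le> n. P i \<in> S" "\<forall>i < n. P i \<subset> P (Suc i)"
    by blast
  then have "(\<forall>i \<le> n. f (P i) \<in> T) \<and> (\<forall>i < n. f (P i) \<subset> f (P (Suc i)))"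
    by (simp add: assms)
  then show "n \<in> {n. \<exists>P :: nat \<Rightarrow> 'b set. (\<forall>i \<le> n. P i \<in> T) \<and> (\<forall>i < n. P i \<subset> P (Suc i))}"
    by (intro CollectI exI[of _ "\<lambda>i. f (P i)"])
qed simp

lemma chain_dim_mono: "S \<subseteq> T \<Longrightarrow> chain_dim S \<le> chain_dim T"
  by (rule chain_dim_le_of_strict_mono[where f = id]) auto

text \<open>In arbitrary families a chain could alternate between the two. Sets of the form
  \<open>V R K\<close> are upward closed among primes, so a chain never leaves the one in which it
  starts.\<close>

lemma chain_dim_V_le:
  assumes "S \<subseteq> V R I \<union> V R J"
    and "chain_dim (V R I) \<le> d" and "chain_dim (V R J) \<le> d"
  shows "chain_dim S \<le> d"
  unfolding chain_dim_def
proof (rule SUP_least)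
  fix n
  assume "n \<in> {n. \<exists>P :: nat \<Rightarrow> 'a set. (\<forall>i \<le> n. P i \<in> S) \<and> (\<forall>i < n. P i \<subset> P (Suc i))}"
  then obtain P where P: "\<And>i. i \<le> n \<Longrightarrow> P i \<in> S" and step: "\<And>i. i < n \<Longrightarrow> P i \<subset> P (Suc i)"
    by blast
  have smallest: "P 0 \<subseteq> P i" if "i \<le> n" for i
    using that
  proof (induction i)
    case (Suc i)
    then show ?case
      using step[of i] by auto
  qed simp
  \<comment> \<open>\<open>K\<close> stands for whichever of \<open>I\<close> and \<open>J\<close>
    is contained in the first prime of the chain.\<close>
  have "ereal (real n) \<le> d" if K: "P 0 \<in> V R K" "chain_dim (V R K) \<le> d" for K
  proof -
    have "P i \<in> V R K" if "i \<le> n" for i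
      using K(1) smallest[OF that] P[OF that] assms(1) by (auto simp: V_def)
    then have "ereal (real n) \<le> chain_dim (V R K)"
      unfolding chain_dim_def by (intro SUP_upper) (use step in blast)
    with K(2) show ?thesis
      by simp
  qed
  moreover have "P 0 \<in> V R I \<union> V R J"
    using P[of 0] assms(1) by blast
  ultimately show "ereal (real n) \<le> d"
    using assms(2,3) by blast
qed

section \<open>Prime ideals of a quotient ring\<close>

lemma ideal_annihilator:
  assumes "module R M"
  shows "ideal (annihilator R M) R"
proof -
  interpret module R M by fact
  show ?thesis
  proof (rule idealI[OF R.ring_axioms])
    show "subgroup (annihilator R M) (add_monoid R)"
      by (rule R.add.subgroupI)
        (auto simp: annihilator_def smult_l_distr smult_l_minus simp flip: a_inv_def)
  qed (auto simp: annihilator_def smult_assoc1 R.m_comm)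
qed

text \<open>An ideal containing \<open>I\<close> is a union of cosets of \<open>I\<close>. Hence
  \<open>Union\<close> undoes the passage to R / I on such ideals.\<close>

lemma (in ring) Union_image_coset:
  assumes "ideal I R" and "ideal J R" and "I \<subseteq> J"
  shows "\<Union>((+>) I ` J) = J"
  using iffD1[OF ideal_incl_iff[OF assms(1,2)] assms(3)] by (rule sym)

text \<open>As \<open>P\<close> contains \<open>I\<close>, membership of a coset in the image can be
  tested on any representative, so properness and primality descend from \<open>P\<close>.\<close>

lemma (in cring) image_in_Spec_Quot:
  assumes I: "ideal I R" and P: "P \<in> V R I"
  shows "(+>) I ` P \<in> Spec (R Quot I)"
proof -
  interpret P: primeideal P R
    using P by (simp add: V_def Spec_def)
  have image: "ideal ((+>) I ` P) (R Quot I)"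
    by (rule ring_ideal_imp_quot_ideal[OF I P.is_ideal])
  have Union: "\<Union>((+>) I ` P) = P"
    using P Union_image_coset[OF I P.is_ideal] by (simp add: V_def)
  have sub: "(+>) I ` P \<subseteq> carrier (R Quot I)"
    by (rule additive_subgroup.a_subset[OF ideal.axioms(1)[OF image]])
  \<comment> \<open>The preimage of the image of \<open>P\<close> is the union of its cosets, which
    is \<open>P\<close> again.\<close>
  have mem: "r \<in> P" if "r \<in> carrier R" "I +> r \<in> (+>) I ` P" for r
    using canonical_proj_vimage_mem_iff[OF I sub that(1)] that(2) by (simp only: Union)
  have "primeideal ((+>) I ` P) (R Quot I)"
  proof (rule primeidealI)
    show "ideal ((+>) I ` P) (R Quot I)"
      by (rule image)
    show "cring (R Quot I)"
      by (rule ideal.quotient_is_cring[OF I is_cring])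
    have "\<one> \<notin> P"
      using P.I_notcarr P.one_imp_carrier by blast
    then have "I +> \<one> \<notin> (+>) I ` P"
      using mem by blast
    moreover have "I +> \<one> \<in> carrier (R Quot I)"
      by (rule ring_hom_closed[OF ideal.rcos_ring_hom[OF I] one_closed])
    ultimately show "carrier (R Quot I) \<noteq> (+>) I ` P"
      by metis
  next
    fix A B
    assume "A \<in> carrier (R Quot I)" "B \<in> carrier (R Quot I)" and AB: "A \<otimes>\<^bsub>R Quot I\<^esub> B \<in> (+>) I ` P"
    then obtain a b where ab: "a \<in> carrier R" "A = I +> a" "b \<in> carrier R" "B = I +> b"
      by (auto simp: FactRing_def A_RCOSETS_def')
    have "A \<otimes>\<^bsub>R Quot I\<^esub> B = I +> a \<otimes> b"
      unfolding ab(2,4) by (rule ring_hom_mult[OF ideal.rcos_ring_hom[OF I] ab(1,3), symmetric])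
    then have "a \<otimes> b \<in> P"
      using mem[OF m_closed[OF ab(1,3)]] AB by simp
    then have "a \<in> P \<or> b \<in> P"
      by (rule P.I_prime[OF ab(1,3)])
    then show "A \<in> (+>) I ` P \<or> B \<in> (+>) I ` P"
      using ab by blast
  qed
  then show ?thesis
    by (simp add: Spec_def)
qed

text \<open>The union is the preimage of \<open>Q\<close> under the projection, and preimages of
  primes are prime.\<close>

lemma (in cring) Union_in_V:
  assumes I: "ideal I R" and Q: "Q \<in> Spec (R Quot I)"
  shows "\<Union>Q \<in> V R I"
proof -
  interpret Q: primeideal Q "R Quot I"
    using Q by (simp add: Spec_def)
  have "\<Union>Q = {r \<in> carrier R. I +> r \<in> Q}"
    using canonical_proj_vimage_in_carrier[OF I Q.a_subset]
      canonical_proj_vimage_mem_iff[OF I Q.a_subset] by blast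
  then have "primeideal (\<Union>Q) R"
    using ring_hom_ring.primeideal_vimage[OF ideal.rcos_ring_hom_ring[OF I] is_cring Q.primeideal]
    by simp
  \<comment> \<open>\<open>I\<close> is the zero of the quotient, hence a member of \<open>Q\<close>
    and a subset of its union.\<close>
  moreover have "I \<in> Q"
    using additive_subgroup.zero_closed[OF Q.is_additive_subgroup] by (simp add: FactRing_def)
  ultimately show ?thesis
    by (auto simp: V_def Spec_def)
qed

text \<open>Image and union are mutually inverse and preserve inclusion, so chains of primes
  transfer both ways; each direction gives one inequality.\<close>

lemma (in cring) krull_dim_Quot:
  assumes I: "ideal I R"
  shows "krull_dim (R Quot I) = chain_dim (V R I)"
proof -
  let ?\<phi> = "\<lambda>J. (+>) I ` J"
  \<comment> \<open>The correspondence for all ideals serves to write each prime of R / I as the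
    image of an ideal containing \<open>I\<close>.\<close>
  have bij: "bij_betw ?\<phi> {J. ideal J R \<and> I \<subseteq> J} {J. ideal J (R Quot I)}"
    by (rule quot_ideal_correspondence[OF I])
  have Union_image: "\<Union>(?\<phi> P) = P" if "P \<in> V R I" for P
    using that by (intro Union_image_coset[OF I]) (auto simp: V_def Spec_def dest: primeideal.axioms(1))
  have image_Union: "?\<phi> (\<Union>Q) = Q" if "Q \<in> Spec (R Quot I)" for Q
  proof -
    have "ideal Q (R Quot I)"
      using that by (simp add: Spec_def primeideal.axioms(1))
    then have "Q \<in> ?\<phi> ` {J. ideal J R \<and> I \<subseteq> J}"
      by (simp only: bij_betw_imp_surj_on[OF bij] mem_Collect_eq)
    then obtain J where Q: "Q = ?\<phi> J" and J: "ideal J R" "I \<subseteq> J"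
      by (elim imageE CollectE conjE)
    show ?thesis
      by (simp only: Q Union_image_coset[OF I J])
  qed
  have "chain_dim (Spec (R Quot I)) \<le> chain_dim (V R I)"
  proof (rule chain_dim_le_of_strict_mono[where f = Union])
    fix P Q assume PQ: "P \<in> Spec (R Quot I)" "Q \<in> Spec (R Quot I)" "P \<subset> Q"
    \<comment> \<open>Unions preserve inclusion; injectivity, from the left inverse, makes it
      strict.\<close>
    have "inj_on Union (Spec (R Quot I))"
      by (rule inj_on_inverseI[where g = ?\<phi>]) (rule image_Union)
    then have "\<Union>P \<noteq> \<Union>Q"
      using PQ by (intro inj_on_contraD[of Union]) (auto simp only: psubset_eq)
    then show "\<Union>P \<subset> \<Union>Q"
      using PQ(3) by blast
  qed (rule Union_in_V[OF I])
  moreover have "chain_dim (V R I) \<le> chain_dim (Spec (R Quot I))"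
  proof (rule chain_dim_le_of_strict_mono[where f = ?\<phi>])
    fix P Q assume PQ: "P \<in> V R I" "Q \<in> V R I" "P \<subset> Q"
    have "inj_on ?\<phi> (V R I)"
      by (rule inj_on_inverseI[where g = Union]) (rule Union_image)
    then have "?\<phi> P \<noteq> ?\<phi> Q"
      using PQ by (intro inj_on_contraD[of ?\<phi>]) (auto simp only: psubset_eq)
    then show "?\<phi> P \<subset> ?\<phi> Q"
      using PQ(3) by blast
  qed (rule image_in_Spec_Quot[OF I])
  ultimately show ?thesis
    by (simp add: krull_dim_eq_chain_dim)
qed

section \<open>Annihilators along linear maps and exact sequences\<close>

lemma linear_map_zero:
  assumes "module R L" and "module R M" and "f \<in> linear_maps R L M"
  shows "f \<zero>\<^bsub>L\<^esub> = \<zero>\<^bsub>M\<^esub>"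
proof -
  interpret L: module R L by fact
  interpret M: module R M by fact
  \<comment> \<open>\<open>linear_maps\<close> does not postulate that zero is preserved; scaling by
    the zero of \<open>R\<close> yields it.\<close>
  have "f (\<zero>\<^bsub>R\<^esub> \<odot>\<^bsub>L\<^esub> \<zero>\<^bsub>L\<^esub>) = \<zero>\<^bsub>R\<^esub> \<odot>\<^bsub>M\<^esub> f \<zero>\<^bsub>L\<^esub>"
    using assms(3) L.R.zero_closed L.M.zero_closed unfolding linear_maps_def by blast
  moreover have "f \<zero>\<^bsub>L\<^esub> \<in> carrier M"
    using assms(3) by (auto simp: linear_maps_def)
  ultimately show ?thesis
    by simp
qed

text \<open>If r kills M, then f(rx) = r f(x) = 0 = f(0), and injectivity cancels
  \<open>f\<close>.\<close>

lemma annihilator_mono_inj: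
  assumes L: "module R L" and M: "module R M" and f: "f \<in> linear_maps R L M"
    and inj: "inj_on f (carrier L)"
  shows "annihilator R M \<subseteq> annihilator R L"
proof
  interpret L: module R L by fact
  fix r assume r: "r \<in> annihilator R M"
  have "r \<odot>\<^bsub>L\<^esub> x = \<zero>\<^bsub>L\<^esub>" if x: "x \<in> carrier L" for x
  proof (rule inj_onD[OF inj])
    show "f (r \<odot>\<^bsub>L\<^esub> x) = f \<zero>\<^bsub>L\<^esub>"
      using r x f linear_map_zero[OF L M f] by (auto simp: annihilator_def linear_maps_def)
  qed (use r x in \<open>auto simp: annihilator_def\<close>)
  then show "r \<in> annihilator R L"
    using r by (simp add: annihilator_def)
qed

text \<open>Each y is some g(x), and r g(x) = g(rx) = g(0) = 0 when r kills M.\<close>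

lemma annihilator_mono_surj:
  assumes M: "module R M" and N: "module R N" and g: "g \<in> linear_maps R M N"
    and surj: "g ` carrier M = carrier N"
  shows "annihilator R M \<subseteq> annihilator R N"
proof
  fix r assume r: "r \<in> annihilator R M"
  have "r \<odot>\<^bsub>N\<^esub> y = \<zero>\<^bsub>N\<^esub>" if y: "y \<in> carrier N" for y
  proof -
    obtain x where x: "x \<in> carrier M" "y = g x"
      using y surj by blast
    have "g (r \<odot>\<^bsub>M\<^esub> x) = r \<odot>\<^bsub>N\<^esub> g x"
      using r g x(1) unfolding annihilator_def linear_maps_def by blast
    then show ?thesis
      using r x linear_map_zero[OF M N g] by (simp add: annihilator_def)
  qed
  then show "r \<in> annihilator R N"
    using r by (simp add: annihilator_def)
qed

text \<open>Multiplication by \<open>b\<close> moves M into the kernel of \<open>g\<close>, which is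
  the image of L, and \<open>a\<close> kills that image.\<close>

lemma annihilator_mult_short_exact:
  assumes L: "module R L" and M: "module R M" and exact: "short_exact R L f M g N"
    and a: "a \<in> annihilator R L" and b: "b \<in> annihilator R N"
  shows "a \<otimes>\<^bsub>R\<^esub> b \<in> annihilator R M"
proof -
  interpret M: module R M by fact
  have f: "f \<in> linear_maps R L M" and g: "g \<in> linear_maps R M N"
    and ker: "f ` carrier L = a_kernel M N g"
    using exact by (auto simp: short_exact_def)
  have carr: "a \<in> carrier R" "b \<in> carrier R"
    using a b by (auto simp: annihilator_def)
  have "(a \<otimes>\<^bsub>R\<^esub> b) \<odot>\<^bsub>M\<^esub> x = \<zero>\<^bsub>M\<^esub>" if x: "x \<in> carrier M" for x
  proof -
    have "g (b \<odot>\<^bsub>M\<^esub> x) = \<zero>\<^bsub>N\<^esub>"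
      using b g x by (auto simp: annihilator_def linear_maps_def)
    then have "b \<odot>\<^bsub>M\<^esub> x \<in> f ` carrier L"
      using carr x by (simp add: ker a_kernel_def')
    then obtain y where y: "y \<in> carrier L" "b \<odot>\<^bsub>M\<^esub> x = f y"
      by blast
    have "(a \<otimes>\<^bsub>R\<^esub> b) \<odot>\<^bsub>M\<^esub> x = a \<odot>\<^bsub>M\<^esub> f y"
      using carr x y by (simp add: M.smult_assoc1)
    also have "\<dots> = f (a \<odot>\<^bsub>L\<^esub> y)"
      using carr y f by (simp add: linear_maps_def)
    also have "\<dots> = \<zero>\<^bsub>M\<^esub>"
      using a y linear_map_zero[OF L M f] by (simp add: annihilator_def)
    finally show ?thesis .
  qed
  then show ?thesis
    using carr by (simp add: annihilator_def)
qed

section \<open>Primes over annihilators and the Serre property\<close>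

lemma V_antimono: "I \<subseteq> J \<Longrightarrow> V R J \<subseteq> V R I"
  by (auto simp: V_def)

lemma V_annihilator_short_exact:
  assumes "module R L" and "module R M" and "short_exact R L f M g N"
  shows "V R (annihilator R M) \<subseteq> V R (annihilator R L) \<union> V R (annihilator R N)"
proof
  fix P assume P: "P \<in> V R (annihilator R M)"
  interpret primeideal P R
    using P by (simp add: V_def Spec_def)
  \<comment> \<open>If some \<open>a\<close> lies outside \<open>P\<close>, this puts every
    \<open>b\<close> into \<open>P\<close>; so \<open>P\<close> contains one of the two annihilators
    entirely.\<close>
  have "a \<in> P \<or> b \<in> P" if "a \<in> annihilator R L" "b \<in> annihilator R N" for a b
    using that annihilator_mult_short_exact[OF assms that] P I_prime[of a b]
    by (auto simp: V_def annihilator_def)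
  then show "P \<in> V R (annihilator R L) \<union> V R (annihilator R N)"
    using P by (auto simp: V_def)
qed

text \<open>\<open>\<Phi>\<close> abstracts the dimension bound and finiteness. \<open>mono\<close>
  serves subobjects and quotients, \<open>union\<close> extensions. The latter speaks of sets
  \<open>V R I\<close> because the dimension bound passes to unions by their upward closure.\<close>

lemma Serre_subcategory_V_annihilator:
  fixes R :: "('r, 'q) ring_scheme"
  assumes mono: "\<And>S T. S \<subseteq> T \<Longrightarrow> \<Phi> T \<Longrightarrow> \<Phi> S"
    and union: "\<And>S I J. S \<subseteq> V R I \<union> V R J \<Longrightarrow> \<Phi> (V R I) \<Longrightarrow> \<Phi> (V R J) \<Longrightarrow> \<Phi> S"
  shows "Serre_subcategory R {M \<in> Modules R :: ('r, 'm) module set. \<Phi> (V R (annihilator R M))}"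
    (is "Serre_subcategory R ?C")
proof -
  have "closed_under_subobjects R ?C"
    unfolding closed_under_subobjects_def
  proof (intro ballI impI)
    fix M L :: "('r, 'm) module" and f
    assume *: "M \<in> ?C" "L \<in> Modules R" "f \<in> linear_maps R L M" "inj_on f (carrier L)"
    then have "V R (annihilator R L) \<subseteq> V R (annihilator R M)"
      by (intro V_antimono annihilator_mono_inj[of R L M f]) (auto simp: Modules_def)
    then show "L \<in> ?C"
      using mono * by blast
  qed
  moreover have "closed_under_quotients R ?C"
    unfolding closed_under_quotients_def
  proof (intro ballI impI)
    fix M N :: "('r, 'm) module" and g
    assume *: "M \<in> ?C" "N \<in> Modules R" "g \<in> linear_maps R M N" "g ` carrier M = carrier N"
    then have "V R (annihilator R N) \<subseteq> V R (annihilator R M)"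
      by (intro V_antimono annihilator_mono_surj[of R M N g]) (auto simp: Modules_def)
    then show "N \<in> ?C"
      using mono * by blast
  qed
  moreover have "closed_under_extensions R ?C"
    unfolding closed_under_extensions_def
  proof (intro ballI allI impI)
    fix L N M :: "('r, 'm) module" and f g
    assume *: "L \<in> ?C" "N \<in> ?C" "M \<in> Modules R" "short_exact R L f M g N"
    then have "V R (annihilator R M) \<subseteq> V R (annihilator R L) \<union> V R (annihilator R N)"
      by (intro V_annihilator_short_exact[of R L M f g N]) (auto simp: Modules_def)
    then show "M \<in> ?C"
      using union * by blast
  qed
  ultimately show ?thesis
    by (auto simp: Serre_subcategory_def)
qed

theorem corollary3p5:
  fixes R :: "('r, 'q) ring_scheme"
  assumes "cring R" and "noetherian_ring R"
  shows "(\<forall>n :: nat. Serre_subcategory R (D_le R n :: ('r, 'm) module set)) \<and>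
         Serre_subcategory R (G_fin R :: ('r, 'm) module set)"
proof (intro conjI allI)
  interpret cring R by fact
  fix n :: nat
  \<comment> \<open>Annihilators are ideals, so the dimension of R / Ann M turns into a condition on
    the primes over Ann M.\<close>
  have "D_le R n = {M \<in> Modules R :: ('r, 'm) module set.
      chain_dim (V R (annihilator R M)) \<le> ereal (real n)}"
    by (auto simp: D_le_def dim_bar_def Modules_def krull_dim_Quot ideal_annihilator)
  moreover have "Serre_subcategory R \<dots>"
    by (rule Serre_subcategory_V_annihilator)
      (blast intro: order_trans chain_dim_mono chain_dim_V_le)+
  ultimately show "Serre_subcategory R (D_le R n :: ('r, 'm) module set)"
    by simp
next
  show "Serre_subcategory R (G_fin R :: ('r, 'm) module set)"
    unfolding G_fin_def
    \<comment> \<open>Here \<open>\<Phi>\<close> is \<open>finite\<close>, which passes to subsets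
      and to unions of two sets.\<close>
    by (rule Serre_subcategory_V_annihilator) (auto intro: finite_subset)
qed

end
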